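(* Consider any static axisymmetric vacuum spacetime of Weyl's class, with smooth $\lambda,\mu$ on a connected open subset of the half-plane $\{\rho>0\}$. Let $K$ be a rank-2 Killing tensor of the canonical form with $q=+1$ and $\lambda_3=0$, i.e. $$K=\lambda_0(\theta^1\otimes\theta^1+\theta^2\otimes\theta^2)+\lambda_1(\theta^1\otimes\theta^2+\theta^2\otimes\theta^1)+\lambda_2(\theta^3\otimes\theta^4+\theta^4\otimes\theta^3),$$ where $\lambda_0,\lambda_1,\lambda_2$ are smooth real functions of $(\rho,z)$. Then $\lambda_2$ is constant and there are real constants $N_1,N_2$ such that $$\lambda_0=\tfrac12\big[N_1e^{2\lambda}+N_2\rho^2e^{-2\lambda}\big],\qquad \lambda_1=\tfrac12\big[N_1e^{2\lambda}-N_2\rho^2e^{-2\lambda}\big]-\lambda_2,$$ and $K$ is reducible, namely $$K^{\mu\nu}=N_1\,\xi_t^\mu\xi_t^\nu+N_2\,\xi_\phi^\mu\xi_\phi^\nu-\lambda_2\,g^{\mu\nu},$$ where $\xi_t=\partial_t$ and $\xi_\phi=\partial_\phi$.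
   Context: A static axisymmetric vacuum metric of Weyl's class is, in coordinates $(t,\phi,\rho,z)$ with $\rho>0$, $ds^2=e^{2\lambda}dt^2-e^{-2\lambda}[\rho^2d\phi^2+e^{2\mu}(d\rho^2+dz^2)]$, where $\lambda,\mu$ are real functions of $(\rho,z)$ satisfying $\lambda_{\rho\rho}+\lambda_\rho/\rho+\lambda_{zz}=0$, $\mu_\rho=\rho(\lambda_\rho^2-\lambda_z^2)$, $\mu_z=2\rho\lambda_\rho\lambda_z$. The function $\lambda$ in the metric is distinct from the scalars $\lambda_0,\lambda_1,\lambda_2$. Null coframe: $\theta^1=\frac{1}{\sqrt2}(e^{\lambda}dt+\rho e^{-\lambda}d\phi)$, $\theta^2=\frac1{\sqrt2}(e^{\lambda}dt-\rho e^{-\lambda}d\phi)$, $\theta^3=-\frac{e^{\mu-\lambda}}{\sqrt2}(d\rho-i\,dz)$, $\theta^4=-\frac{e^{\mu-\lambda}}{\sqrt2}(d\rho+i\,dz)$, so that $ds^2=2(\theta^1\theta^2-\theta^3\theta^4)$. A rank-2 Killing tensor is a symmetric tensor $K_{\mu\nu}$ with $\nabla_{(\alpha}K_{\mu\nu)}=0$. It is called reducible if it is a linear combination, with constant coefficients, of the metric and symmetrized products of Killing vector fields of the spacetime. *)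

theory Defs
  imports "HOL-Analysis.Analysis"
begin

section \<open>Smooth functions and partial derivatives\<close>

definition pd :: "'a::real_normed_vector \<Rightarrow> ('a \<Rightarrow> 'b::real_normed_vector) \<Rightarrow> 'a \<Rightarrow> 'b" where
  "pd v f x = frechet_derivative f (at x) v"

text \<open>Only used on open sets.\<close>

primrec Ck_on :: "nat \<Rightarrow> 'a::euclidean_space set \<Rightarrow> ('a \<Rightarrow> 'b::real_normed_vector) \<Rightarrow> bool" where
  "Ck_on 0 S f \<longleftrightarrow> continuous_on S f"
| "Ck_on (Suc k) S f \<longleftrightarrow> (\<forall>x\<in>S. f differentiable (at x)) \<and> (\<forall>v\<in>Basis. Ck_on k S (pd v f))"

definition smooth_on :: "'a::euclidean_space set \<Rightarrow> ('a \<Rightarrow> 'b::real_normed_vector) \<Rightarrow> bool" where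
  "smooth_on S f \<longleftrightarrow> (\<forall>k. Ck_on k S f)"


section \<open>Tensor calculus in a global coordinate chart\<close>

text \<open>
  A chart is an open set of \<open>real^'n\<close>; a field is given by its coordinate components,
  with indices in the type \<open>'n\<close>.
\<close>

type_synonym 'n vfield = "real^'n \<Rightarrow> real^'n"
type_synonym 'n tensor2 = "real^'n \<Rightarrow> real^'n^'n"

abbreviation coord_pd :: "'n::finite \<Rightarrow> (real^'n \<Rightarrow> real) \<Rightarrow> real^'n \<Rightarrow> real" where
  "coord_pd i \<equiv> pd (axis i 1)"

definition ginv :: "'n::finite tensor2 \<Rightarrow> 'n tensor2" where
  "ginv g x = matrix_inv (g x)"

text \<open>\<open>christoffel g x s a b\<close> is $\Gamma^s_{ab}$ of the Levi-Civita connection.\<close>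

definition christoffel :: "'n::finite tensor2 \<Rightarrow> real^'n \<Rightarrow> 'n \<Rightarrow> 'n \<Rightarrow> 'n \<Rightarrow> real" where
  "christoffel g x s a b = (\<Sum>d\<in>UNIV. ginv g x $ s $ d *
     (coord_pd a (\<lambda>y. g y $ d $ b) x + coord_pd b (\<lambda>y. g y $ d $ a) x
       - coord_pd d (\<lambda>y. g y $ a $ b) x)) / 2"

text \<open>Covariant derivatives of covectors and of covariant 2-tensors; the derivative index comes first.\<close>

definition nabla1 :: "'n::finite tensor2 \<Rightarrow> 'n vfield \<Rightarrow> real^'n \<Rightarrow> 'n \<Rightarrow> 'n \<Rightarrow> real" where
  "nabla1 g w x a m = coord_pd a (\<lambda>y. w y $ m) x - (\<Sum>s\<in>UNIV. christoffel g x s a m * w x $ s)"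

definition nabla2 :: "'n::finite tensor2 \<Rightarrow> 'n tensor2 \<Rightarrow> real^'n \<Rightarrow> 'n \<Rightarrow> 'n \<Rightarrow> 'n \<Rightarrow> real" where
  "nabla2 g K x a m n = coord_pd a (\<lambda>y. K y $ m $ n) x
     - (\<Sum>s\<in>UNIV. christoffel g x s a m * K x $ s $ n)
     - (\<Sum>s\<in>UNIV. christoffel g x s a n * K x $ m $ s)"

definition lower :: "'n::finite tensor2 \<Rightarrow> 'n vfield \<Rightarrow> 'n vfield" where
  "lower g \<xi> x = (\<chi> m. \<Sum>n\<in>UNIV. g x $ m $ n * \<xi> x $ n)"

definition raise2 :: "'n::finite tensor2 \<Rightarrow> 'n tensor2 \<Rightarrow> 'n tensor2" where
  "raise2 g K x = (\<chi> m n. \<Sum>a\<in>UNIV. \<Sum>b\<in>UNIV. ginv g x $ m $ a * ginv g x $ n $ b * K x $ a $ b)"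

definition killing_vector_on :: "(real^'n) set \<Rightarrow> 'n::finite tensor2 \<Rightarrow> 'n vfield \<Rightarrow> bool" where
  "killing_vector_on M g \<xi> \<longleftrightarrow> smooth_on M \<xi> \<and>
     (\<forall>x\<in>M. \<forall>a b. (nabla1 g (lower g \<xi>) x a b + nabla1 g (lower g \<xi>) x b a) / 2 = 0)"

definition sym3 :: "('n \<Rightarrow> 'n \<Rightarrow> 'n \<Rightarrow> real) \<Rightarrow> 'n \<Rightarrow> 'n \<Rightarrow> 'n \<Rightarrow> real" where
  "sym3 T a m n = (T a m n + T a n m + T m a n + T m n a + T n a m + T n m a) / 6"

definition killing_tensor2_on :: "(real^'n) set \<Rightarrow> 'n::finite tensor2 \<Rightarrow> 'n tensor2 \<Rightarrow> bool" where
  "killing_tensor2_on M g K \<longleftrightarrow> smooth_on M K \<and>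
     (\<forall>x\<in>M. \<forall>m n. K x $ m $ n = K x $ n $ m) \<and>
     (\<forall>x\<in>M. \<forall>a m n. sym3 (nabla2 g K x) a m n = 0)"

definition sym_prod :: "real^'n \<Rightarrow> real^'n \<Rightarrow> real^'n^'n" where
  "sym_prod v w = (\<chi> m n. (v $ m * w $ n + w $ m * v $ n) / 2)"

definition reducible_on :: "(real^'n) set \<Rightarrow> 'n::finite tensor2 \<Rightarrow> 'n tensor2 \<Rightarrow> bool" where
  "reducible_on M g K \<longleftrightarrow>
     (\<exists>(c::real) (k::nat) (C :: nat \<Rightarrow> real) (\<xi> :: nat \<Rightarrow> 'n vfield) (\<eta> :: nat \<Rightarrow> 'n vfield).
        (\<forall>i<k. killing_vector_on M g (\<xi> i) \<and> killing_vector_on M g (\<eta> i)) \<and>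
        (\<forall>x\<in>M. K x = c *\<^sub>R g x +
           (\<Sum>i<k. C i *\<^sub>R sym_prod (lower g (\<xi> i) x) (lower g (\<eta> i) x))))"


section \<open>Weyl's class\<close>

text \<open>Points of the half-plane are pairs $(\rho,z)$.\<close>

abbreviation d_rho :: "(real \<times> real \<Rightarrow> real) \<Rightarrow> real \<times> real \<Rightarrow> real" where
  "d_rho \<equiv> pd (1, 0)"

abbreviation d_z :: "(real \<times> real \<Rightarrow> real) \<Rightarrow> real \<times> real \<Rightarrow> real" where
  "d_z \<equiv> pd (0, 1)"

definition weyl_vacuum :: "(real \<times> real) set \<Rightarrow> (real \<times> real \<Rightarrow> real) \<Rightarrow> (real \<times> real \<Rightarrow> real) \<Rightarrow> bool" where
  "weyl_vacuum U lam mu \<longleftrightarrow>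
     open U \<and> connected U \<and> (\<forall>p\<in>U. fst p > 0) \<and> smooth_on U lam \<and> smooth_on U mu \<and>
     (\<forall>p\<in>U. d_rho (d_rho lam) p + d_rho lam p / fst p + d_z (d_z lam) p = 0) \<and>
     (\<forall>p\<in>U. d_rho mu p = fst p * ((d_rho lam p)\<^sup>2 - (d_z lam p)\<^sup>2)) \<and>
     (\<forall>p\<in>U. d_z mu p = 2 * fst p * d_rho lam p * d_z lam p)"

text \<open>
  The coordinates $(t,\phi,\rho,z)$ are the components 1, 2, 3, 4 (where \<open>4 = 0\<close> in the type \<open>4\<close>).
  As all the data are independent of $\phi$, the angle is taken in \<open>real\<close>.
\<close>

definition rz :: "real^4 \<Rightarrow> real \<times> real" where
  "rz x = (x $ 3, x $ 4)"

definition spacetime :: "(real \<times> real) set \<Rightarrow> (real^4) set" where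
  "spacetime U = {x. rz x \<in> U}"

definition weyl_metric :: "(real \<times> real \<Rightarrow> real) \<Rightarrow> (real \<times> real \<Rightarrow> real) \<Rightarrow> 4 tensor2" where
  "weyl_metric lam mu x = (let l = lam (rz x); u = mu (rz x); \<rho> = x $ 3 in
     \<chi> m n. if m \<noteq> n then 0
       else if m = 1 then exp (2 * l)
       else if m = 2 then - (exp (- 2 * l) * \<rho>\<^sup>2)
       else - (exp (- 2 * l) * exp (2 * u)))"

definition dx :: "4 \<Rightarrow> complex^4" where
  "dx i = axis i 1"

definition theta1 :: "(real \<times> real \<Rightarrow> real) \<Rightarrow> real^4 \<Rightarrow> complex^4" where
  "theta1 lam x = of_real (1 / sqrt 2) *s
     (of_real (exp (lam (rz x))) *s dx 1 + of_real (x $ 3 * exp (- lam (rz x))) *s dx 2)"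

definition theta2 :: "(real \<times> real \<Rightarrow> real) \<Rightarrow> real^4 \<Rightarrow> complex^4" where
  "theta2 lam x = of_real (1 / sqrt 2) *s
     (of_real (exp (lam (rz x))) *s dx 1 - of_real (x $ 3 * exp (- lam (rz x))) *s dx 2)"

definition theta3 :: "(real \<times> real \<Rightarrow> real) \<Rightarrow> (real \<times> real \<Rightarrow> real) \<Rightarrow> real^4 \<Rightarrow> complex^4" where
  "theta3 lam mu x = of_real (- exp (mu (rz x) - lam (rz x)) / sqrt 2) *s (dx 3 - \<i> *s dx 4)"

definition theta4 :: "(real \<times> real \<Rightarrow> real) \<Rightarrow> (real \<times> real \<Rightarrow> real) \<Rightarrow> real^4 \<Rightarrow> complex^4" where
  "theta4 lam mu x = of_real (- exp (mu (rz x) - lam (rz x)) / sqrt 2) *s (dx 3 + \<i> *s dx 4)"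

definition tprod :: "complex^4 \<Rightarrow> complex^4 \<Rightarrow> complex^4^4" where
  "tprod v w = (\<chi> m n. v $ m * w $ n)"

definition complexify :: "real^4^4 \<Rightarrow> complex^4^4" where
  "complexify A = (\<chi> m n. of_real (A $ m $ n))"

lemma weyl_metric_coframe:
  "complexify (weyl_metric lam mu x) =
     tprod (theta1 lam x) (theta2 lam x) + tprod (theta2 lam x) (theta1 lam x)
     - tprod (theta3 lam mu x) (theta4 lam mu x) - tprod (theta4 lam mu x) (theta3 lam mu x)"
proof -
  have s: "complex_of_real (sqrt 2) * complex_of_real (sqrt 2) = 2"
    by (metis abs_numeral of_real_mult of_real_numeral real_sqrt_mult_self)
  have e: "exp (2 * a) = (exp a)\<^sup>2" for a :: real
    by (simp add: exp_double)
  show ?thesis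
    unfolding vec_eq_iff forall_4
    by (simp add: complexify_def weyl_metric_def Let_def tprod_def theta1_def theta2_def theta3_def
        theta4_def dx_def axis_def e exp_diff exp_minus field_simps power2_eq_square s)
qed

text \<open>The canonical form with $q=+1$ and $\lambda_3=0$.\<close>

definition canonical_form ::
  "(real \<times> real) set \<Rightarrow> (real \<times> real \<Rightarrow> real) \<Rightarrow> (real \<times> real \<Rightarrow> real) \<Rightarrow>
   (real \<times> real \<Rightarrow> real) \<Rightarrow> (real \<times> real \<Rightarrow> real) \<Rightarrow> (real \<times> real \<Rightarrow> real) \<Rightarrow> 4 tensor2 \<Rightarrow> bool" where
  "canonical_form U lam mu lam0 lam1 lam2 K \<longleftrightarrow>
     (\<forall>x\<in>spacetime U. complexify (K x) =
        lam0 (rz x) *\<^sub>R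
          (tprod (theta1 lam x) (theta1 lam x) + tprod (theta2 lam x) (theta2 lam x))
        + lam1 (rz x) *\<^sub>R
          (tprod (theta1 lam x) (theta2 lam x) + tprod (theta2 lam x) (theta1 lam x))
        + lam2 (rz x) *\<^sub>R
          (tprod (theta3 lam mu x) (theta4 lam mu x) + tprod (theta4 lam mu x) (theta3 lam mu x)))"

definition xi_t :: "4 vfield" where
  "xi_t x = axis 1 1"

definition xi_phi :: "4 vfield" where
  "xi_phi x = axis 2 1"

end

theory Submission
  imports Defs
begin

text \<open>
  In the coordinates $(t,\phi,\rho,z)$ both the metric and $K$ are diagonal. Writing $g_{jj} = G_j$ and
  $K_{jj} = k_j G_j$, the Killing equation becomes $G_j \partial_i k_j = (k_j - k_i) \partial_i G_j$.
  Here $k_3 = k_4 = -\lambda_2$, so the cases $j = 3, 4$ say that $\lambda_2$ is constant, and the cases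
  $j = 1, 2$ say that $(k_j + \lambda_2) / G_j$ is constant; these two constants are $N_1$ and $N_2$.
\<close>

section \<open>Directional derivatives and smoothness\<close>

lemma pd_cong_open:
  assumes "open S" "x \<in> S" "\<And>y. y \<in> S \<Longrightarrow> f y = h y"
  shows "pd v f x = pd v h x"
proof -
  \<comment> \<open>The equivalence holds for every \<open>D\<close>, so the choice made by
    \<open>frechet_derivative\<close> is the same for both functions, even where neither is
    differentiable.\<close>
  have "(f has_derivative D) (at x) \<longleftrightarrow> (h has_derivative D) (at x)" for D
    using has_derivative_transform_within_open[of f D x UNIV S h]
      has_derivative_transform_within_open[of h D x UNIV S f] assms by auto
  then show ?thesis by (simp add: pd_def frechet_derivative_def)
qed

lemma pd_eq:
  assumes "(f has_derivative D) (at x)"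
  shows "pd v f x = D v"
  using frechet_derivative_at[OF assms] by (simp add: pd_def)

lemma pd_const [simp]: "pd v (\<lambda>x. c) x = 0"
  by (rule pd_eq) (auto intro!: derivative_eq_intros)

lemma smooth_on_const: "smooth_on S (\<lambda>x. c)"
proof -
  have "Ck_on k S (\<lambda>x. c)" for k
  proof (induction k arbitrary: c)
    case (Suc k)
    \<comment> \<open>Differentiation replaces \<open>c\<close> by 0, which is why the induction
      generalizes over \<open>c\<close>.\<close>
    have "pd v (\<lambda>x. c) = (\<lambda>x. 0)" for v :: 'a
      by (simp add: fun_eq_iff)
    then show ?case using Suc by simp
  qed auto
  then show ?thesis by (simp add: smooth_on_def)
qed

lemma smooth_on_differentiable:
  assumes "smooth_on S f" "x \<in> S"
  shows "f differentiable (at x)"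
  using assms unfolding smooth_on_def by (metis Ck_on.simps(2))

lemma pd_mult:
  fixes f h :: "'a::real_normed_vector \<Rightarrow> real"
  assumes "f differentiable (at x)" "h differentiable (at x)"
  shows "pd v (\<lambda>y. f y * h y) x = pd v f x * h x + f x * pd v h x"
proof -
  have "((\<lambda>y. f y * h y) has_derivative
      (\<lambda>w. f x * frechet_derivative h (at x) w + frechet_derivative f (at x) w * h x)) (at x)"
    using assms by (intro has_derivative_mult) (auto simp flip: frechet_derivative_works)
  from pd_eq[OF this] show ?thesis by (simp add: pd_def)
qed

text \<open>$(h - c)/G$ has vanishing gradient.\<close>

lemma affine_of_pd:
  fixes h G :: "'a::euclidean_space \<Rightarrow> real"
  assumes "open U" "connected U"
    and h: "\<And>p. p \<in> U \<Longrightarrow> h differentiable (at p)"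
    and G: "\<And>p. p \<in> U \<Longrightarrow> G differentiable (at p)" "\<And>p. p \<in> U \<Longrightarrow> G p \<noteq> 0"
    and eq: "\<And>p v. p \<in> U \<Longrightarrow> v \<in> Basis \<Longrightarrow> pd v h p * G p = (h p - c) * pd v G p"
  shows "\<exists>N. \<forall>p\<in>U. h p = N * G p + c"
proof -
  define W where "W p = (h p - c) / G p" for p
  have W: "(W has_derivative (\<lambda>v. 0)) (at p)" if p: "p \<in> U" for p
  proof -
    let ?h = "frechet_derivative h (at p)" and ?G = "frechet_derivative G (at p)"
    have dh: "(h has_derivative ?h) (at p)" and dG: "(G has_derivative ?G) (at p)"
      using h G p by (auto simp flip: frechet_derivative_works)
    \<comment> \<open>The hypothesis \<open>eq\<close> covers basis directions only; linearity in
      \<open>v\<close> carries it to all directions, where the expression is the numerator of the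
      quotient rule for \<open>W\<close>.\<close>
    have "linear (\<lambda>v. ?h v * G p - (h p - c) * ?G v)"
      using has_derivative_linear[OF dh] has_derivative_linear[OF dG]
      by (auto simp: linear_iff algebra_simps)
    then have "?h v * G p - (h p - c) * ?G v = 0" for v
      using linear_eq_0_on_span[of "\<lambda>v. ?h v * G p - (h p - c) * ?G v" Basis v] eq[OF p]
      by (simp add: pd_def)
    then have *: "?h v * G p = (h p - c) * ?G v" for v
      by (simp add: algebra_simps)
    have "(W has_derivative (\<lambda>v. (?h v * G p - (h p - c) * ?G v) / (G p * G p))) (at p)"
      unfolding W_def using G(2)[OF p]
      by (auto intro!: derivative_eq_intros dh dG)
    then show ?thesis by (simp add: *)
  qed
  have "W constant_on U"
    using has_derivative_zero_unique_connected[OF \<open>open U\<close> \<open>connected U\<close>, of W] W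
    unfolding constant_on_def by (metis)
  then obtain N where N: "\<And>p. p \<in> U \<Longrightarrow> W p = N"
    unfolding constant_on_def by auto
  have "h p = N * G p + c" if "p \<in> U" for p
    using N[OF that] G(2)[OF that] by (simp add: W_def field_simps)
  then show ?thesis by blast
qed


section \<open>Diagonal metrics\<close>

lemma matrix_inv_diagonal:
  fixes A :: "real^'n::finite^'n"
  assumes A: "\<And>a b. A $ a $ b = (if a = b then d a else 0)" and d: "\<And>a. d a \<noteq> 0"
  shows "matrix_inv A $ a $ b = (if a = b then 1 / d a else 0)"
proof -
  define B :: "real^'n^'n" where "B = (\<chi> a b. if a = b then 1 / d a else 0)"
  have "A ** B = mat 1" "B ** A = mat 1"
    by (auto simp: vec_eq_iff matrix_matrix_mult_def mat_def A B_def d mult_delta_left mult_delta_right)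
  \<comment> \<open>\<open>matrix_inv\<close> is a choice among two-sided inverses; their uniqueness
    identifies it with \<open>B\<close>.\<close>
  then have "matrix_inv A = B"
    unfolding matrix_inv_def
    by (intro some_equality) (auto, metis matrix_mul_assoc matrix_mul_lid matrix_mul_rid)
  then show ?thesis by (simp add: B_def)
qed

locale diagonal_metric =
  fixes M :: "(real^'n::finite) set" and g :: "'n tensor2" and G :: "'n \<Rightarrow> real^'n \<Rightarrow> real"
  assumes open_M: "open M"
    and g: "\<And>x a b. x \<in> M \<Longrightarrow> g x $ a $ b = (if a = b then G a x else 0)"
    and nz: "\<And>x a. x \<in> M \<Longrightarrow> G a x \<noteq> 0"
begin

lemma ginv_diagonal:
  assumes "x \<in> M"
  shows "ginv g x $ a $ b = (if a = b then 1 / G a x else 0)"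
  unfolding ginv_def using assms by (intro matrix_inv_diagonal) (auto simp: g nz)

text \<open>The condition \<open>P\<close> compares fixed indices and does not vary with the point,
  so differentiation passes through it; openness of \<open>M\<close> makes agreement on
  \<open>M\<close> sufficient.\<close>

lemma pd_diagonal:
  assumes "x \<in> M" "\<And>y. y \<in> M \<Longrightarrow> f y = (if P then h y else 0)"
  shows "pd v f x = (if P then pd v h x else 0)"
  using pd_cong_open[OF open_M assms(1), of f "\<lambda>y. if P then h y else 0"] assms(2) by auto

text \<open>The diagonal inverse metric leaves only the summand with \<open>d = s\<close>, and each
  metric derivative survives only for equal component indices.\<close>

lemma christoffel_diagonal:
  assumes x: "x \<in> M"
  shows "christoffel g x s a b =
    ((if s = b then coord_pd a (G s) x else 0) + (if s = a then coord_pd b (G s) x else 0)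
      - (if a = b then coord_pd s (G a) x else 0)) / (2 * G s x)"
proof -
  have "coord_pd c (\<lambda>y. g y $ d $ e) x = (if d = e then coord_pd c (G d) x else 0)" for c d e
    using x by (rule pd_diagonal) (rule g)
  then show ?thesis
    by (simp add: christoffel_def ginv_diagonal[OF x] mult_delta_left mult_delta_right)
qed

text \<open>A cyclic coordinate yields a Killing field: the Christoffel terms cancel the derivatives
  of \<open>G c\<close>, and what remains for \<open>a = b\<close> is half of the derivative of
  \<open>G a\<close> along \<open>c\<close>.\<close>

lemma killing_vector_axis:
  assumes cyclic: "\<And>x a. x \<in> M \<Longrightarrow> coord_pd c (G a) x = 0"
  shows "killing_vector_on M g (\<lambda>x. axis c 1)"
  unfolding killing_vector_on_def
proof (intro conjI ballI allI smooth_on_const)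
  fix x a b assume x: "x \<in> M"
  have low: "lower g (\<lambda>x. axis c 1) y $ m = (if m = c then G c y else 0)" if "y \<in> M" for y m
    by (simp add: lower_def g[OF that] axis_def mult_delta_left mult_delta_right)
  have "coord_pd e (\<lambda>y. lower g (\<lambda>x. axis c 1) y $ m) x = (if m = c then coord_pd e (G c) x else 0)"
    for e m using x by (rule pd_diagonal) (rule low)
  then have nab: "nabla1 g (lower g (\<lambda>x. axis c 1)) x e m =
      (if m = c then coord_pd e (G c) x else 0) - christoffel g x c e m * G c x" for e m
    by (simp add: nabla1_def low[OF x] mult_delta_left mult_delta_right)
  show "(nabla1 g (lower g (\<lambda>x. axis c 1)) x a b + nabla1 g (lower g (\<lambda>x. axis c 1)) x b a) / 2 = 0"
    using nz[OF x] cyclic[OF x] by (auto simp: nab christoffel_diagonal[OF x] field_simps)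
qed

lemma killing_tensor2_diagonal:
  assumes K: "killing_tensor2_on M g K"
    and diag: "\<And>x a b. x \<in> M \<Longrightarrow> K x $ a $ b = (if a = b then k a x * G a x else 0)"
    and diff: "\<And>x a. x \<in> M \<Longrightarrow> k a differentiable (at x)" "\<And>x a. x \<in> M \<Longrightarrow> G a differentiable (at x)"
    and x: "x \<in> M"
  shows "coord_pd i (k j) x * G j x = (k j x - k i x) * coord_pd i (G j) x"
proof -
  have "coord_pd e (\<lambda>y. K y $ m $ n) x = (if m = n then coord_pd e (\<lambda>y. k m y * G m y) x else 0)" for e m n
    using x by (rule pd_diagonal) (rule diag)
  then have nab: "nabla2 g K x e m n =
      (if m = n then coord_pd e (k m) x * G m x + k m x * coord_pd e (G m) x else 0)
      - christoffel g x n e m * (k n x * G n x) - christoffel g x m e n * (k m x * G m x)" for e m n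
    by (simp add: nabla2_def diag[OF x] pd_mult diff x mult_delta_left mult_delta_right)
  have "sym3 (nabla2 g K x) i j j = 0"
    using K x by (auto simp: killing_tensor2_on_def)
  then show ?thesis
    using nz[OF x, of i] nz[OF x, of j]
    by (cases "i = j")
      (auto simp: sym3_def nab christoffel_diagonal[OF x] field_simps)
qed

end


section \<open>Weyl's class\<close>

text \<open>The metric coefficients live on the half-plane, not on the chart, so that the equations
  can be integrated over the connected set \<open>U\<close>.\<close>

definition weyl_diag :: "(real \<times> real \<Rightarrow> real) \<Rightarrow> (real \<times> real \<Rightarrow> real) \<Rightarrow> 4 \<Rightarrow> real \<times> real \<Rightarrow> real" where
  "weyl_diag lam mu m p =
     (if m = 1 then exp (2 * lam p)
      else if m = 2 then - (exp (- 2 * lam p) * (fst p)\<^sup>2)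
      else - (exp (- 2 * lam p) * exp (2 * mu p)))"

lemma rz_axis: "rz (axis 1 1) = 0" "rz (axis 2 1) = 0" "rz (axis 3 1) = (1, 0)" "rz (axis 4 1) = (0, 1)"
  by (simp_all add: rz_def axis_def zero_prod_def)

lemma rz_has_derivative: "(rz has_derivative rz) (at x)"
  unfolding rz_def
  by (intro has_derivative_Pair bounded_linear_imp_has_derivative bounded_linear_vec_nth)

lemma pd_rz:
  assumes "f differentiable (at (rz x))"
  shows "pd v (\<lambda>y. f (rz y)) x = pd (rz v) f (rz x)"
proof -
  have "(f has_derivative frechet_derivative f (at (rz x))) (at (rz x))"
    using assms by (simp flip: frechet_derivative_works)
  from pd_eq[OF has_derivative_compose[OF rz_has_derivative this]] show ?thesis
    by (simp add: pd_def)
qed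

lemma differentiable_rz:
  assumes "f differentiable (at (rz x))"
  shows "(\<lambda>y. f (rz y)) differentiable (at x)"
  using assms rz_has_derivative has_derivative_compose unfolding differentiable_def by blast

lemma open_spacetime:
  assumes "open U"
  shows "open (spacetime U)"
proof -
  have "continuous_on UNIV rz"
    unfolding rz_def by (intro continuous_intros)
  from open_vimage[OF assms this] show ?thesis
    by (simp add: spacetime_def vimage_def)
qed

lemma weyl_vacuum_diagonal_metric:
  assumes "weyl_vacuum U lam mu"
  shows "diagonal_metric (spacetime U) (weyl_metric lam mu) (\<lambda>a x. weyl_diag lam mu a (rz x))"
proof
  show "open (spacetime U)"
    using assms by (simp add: weyl_vacuum_def open_spacetime)
  show "weyl_metric lam mu x $ a $ b = (if a = b then weyl_diag lam mu a (rz x) else 0)" for x a b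
    by (simp add: weyl_metric_def weyl_diag_def Let_def rz_def)
  show "weyl_diag lam mu a (rz x) \<noteq> 0" if "x \<in> spacetime U" for x a
  proof -
    have "fst (rz x) > 0"
      using assms that unfolding weyl_vacuum_def spacetime_def by blast
    then show ?thesis by (simp add: weyl_diag_def)
  qed
qed

lemma weyl_diag_differentiable:
  assumes "lam differentiable (at p)" "mu differentiable (at p)"
  shows "weyl_diag lam mu m differentiable (at p)"
proof -
  have exp: "(\<lambda>q. exp (c * f q)) differentiable (at p)" if "f differentiable (at p)"
    for c :: real and f :: "real \<times> real \<Rightarrow> real"
  proof -
    obtain D where "(f has_derivative D) (at p)" using \<open>f differentiable (at p)\<close> by (auto simp: differentiable_def)
    then have "((\<lambda>q. exp (c * f q)) has_derivative (\<lambda>v. exp (c * f p) * (c * D v))) (at p)"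
      by (auto intro!: derivative_eq_intros)
    then show ?thesis by (auto simp: differentiable_def)
  qed
  have "fst differentiable (at p)"
    by (rule bounded_linear_imp_differentiable[OF bounded_linear_fst])
  then have "(\<lambda>q. (fst q)\<^sup>2) differentiable (at p)"
    by (rule differentiable_power)
  then show ?thesis
    using exp[OF assms(1), of 2] exp[OF assms(1), of "- 2"] exp[OF assms(2), of 2]
    unfolding weyl_diag_def
    by (cases "m = 1"; cases "m = 2") (auto intro!: differentiable_minus differentiable_mult)
qed

text \<open>The eigenvalues of $K$ relative to $g$.\<close>

definition weyl_eigen ::
  "(real \<times> real \<Rightarrow> real) \<Rightarrow> (real \<times> real \<Rightarrow> real) \<Rightarrow> (real \<times> real \<Rightarrow> real) \<Rightarrow> 4 \<Rightarrow> real \<times> real \<Rightarrow> real" where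
  "weyl_eigen lam0 lam1 lam2 m =
     (if m = 1 then (\<lambda>p. lam0 p + lam1 p) else if m = 2 then (\<lambda>p. lam1 p - lam0 p) else (\<lambda>p. - lam2 p))"

section \<open>From the null coframe to coordinate components\<close>

lemma complexify_inject: "complexify A = complexify B \<longleftrightarrow> A = B"
  by (simp add: complexify_def vec_eq_iff)

lemma complexify_add: "complexify (A + B) = complexify A + complexify B"
  by (simp add: complexify_def vec_eq_iff)

lemma complexify_scaleR: "complexify (c *\<^sub>R A) = c *\<^sub>R complexify A"
  by (simp add: complexify_def vec_eq_iff scaleR_conv_of_real[where 'a = complex])

text \<open>The cross terms cancel in each symmetric combination. Writing the results as
  complexified real matrices lets \<open>complexify_inject\<close> turn the canonical form into a
  real identity.\<close>

lemma weyl_coframe_products: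
  fixes lam mu :: "real \<times> real \<Rightarrow> real" and x :: "real^4"
  defines "G \<equiv> \<lambda>a. weyl_diag lam mu a (rz x)"
    and "D \<equiv> \<lambda>d :: 4 \<Rightarrow> real. complexify (\<chi> a b. if a = b then d a else 0)"
  shows "tprod (theta1 lam x) (theta1 lam x) + tprod (theta2 lam x) (theta2 lam x) =
      D (\<lambda>a. if a = 1 then G a else if a = 2 then - G a else 0)" (is ?A)
    and "tprod (theta1 lam x) (theta2 lam x) + tprod (theta2 lam x) (theta1 lam x) =
      D (\<lambda>a. if a = 1 \<or> a = 2 then G a else 0)" (is ?B)
    and "tprod (theta3 lam mu x) (theta4 lam mu x) + tprod (theta4 lam mu x) (theta3 lam mu x) =
      D (\<lambda>a. if a = 1 \<or> a = 2 then 0 else - G a)" (is ?C)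
proof -
  have s: "complex_of_real (sqrt 2) * complex_of_real (sqrt 2) = 2"
    by (metis abs_numeral of_real_mult of_real_numeral real_sqrt_mult_self)
  have e: "exp (2 * a) = (exp a)\<^sup>2" for a :: real
    by (simp add: exp_double)
  note defs = complexify_def G_def D_def weyl_diag_def tprod_def theta1_def theta2_def theta3_def
    theta4_def dx_def axis_def e exp_diff exp_minus rz_def
  show ?A
    unfolding vec_eq_iff forall_4 by (simp add: defs field_simps power2_eq_square s)
  show ?B
    unfolding vec_eq_iff forall_4 by (simp add: defs field_simps power2_eq_square s)
  show ?C
    unfolding vec_eq_iff forall_4 by (simp add: defs field_simps power2_eq_square s)
qed

lemma canonical_form_diagonal:
  assumes "canonical_form U lam mu lam0 lam1 lam2 K" "x \<in> spacetime U"
  shows "K x $ a $ b =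
    (if a = b then weyl_eigen lam0 lam1 lam2 a (rz x) * weyl_diag lam mu a (rz x) else 0)"
  using assms(1)[unfolded canonical_form_def, rule_format, OF assms(2)]
  unfolding weyl_coframe_products[where lam = lam and mu = mu and x = x] complexify_scaleR[symmetric] complexify_add[symmetric]
    complexify_inject
  by (simp add: weyl_eigen_def algebra_simps)

theorem mainTheorem3:
  fixes U :: "(real \<times> real) set"
    and lam mu lam0 lam1 lam2 :: "real \<times> real \<Rightarrow> real"
    and K :: "real^4 \<Rightarrow> real^4^4"
  assumes "weyl_vacuum U lam mu"
    and "smooth_on U lam0" and "smooth_on U lam1" and "smooth_on U lam2"
    and "canonical_form U lam mu lam0 lam1 lam2 K"
    and "killing_tensor2_on (spacetime U) (weyl_metric lam mu) K"
  shows "lam2 constant_on U \<and>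
    (\<exists>N1 N2 :: real.
      (\<forall>p\<in>U. lam0 p = (N1 * exp (2 * lam p) + N2 * (fst p)\<^sup>2 * exp (- 2 * lam p)) / 2 \<and>
             lam1 p = (N1 * exp (2 * lam p) - N2 * (fst p)\<^sup>2 * exp (- 2 * lam p)) / 2 - lam2 p) \<and>
      reducible_on (spacetime U) (weyl_metric lam mu) K \<and>
      (\<forall>x\<in>spacetime U. \<forall>m n.
        raise2 (weyl_metric lam mu) K x $ m $ n =
          N1 * xi_t x $ m * xi_t x $ n + N2 * xi_phi x $ m * xi_phi x $ n
          - lam2 (rz x) * ginv (weyl_metric lam mu) x $ m $ n))"
proof -
  let ?M = "spacetime U" and ?g = "weyl_metric lam mu"
  let ?G = "weyl_diag lam mu" and ?k = "weyl_eigen lam0 lam1 lam2"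
  interpret diagonal_metric ?M ?g "\<lambda>a x. ?G a (rz x)"
    using assms(1) by (rule weyl_vacuum_diagonal_metric)
  have U: "open U" "connected U"
    using assms(1) by (auto simp: weyl_vacuum_def)
  have dG: "?G a differentiable (at p)" if "p \<in> U" for a p
    using assms(1) that
    by (intro weyl_diag_differentiable) (auto simp: weyl_vacuum_def smooth_on_differentiable)
  have dk: "?k a differentiable (at p)" if "p \<in> U" for a p
    using smooth_on_differentiable[OF assms(2) that] smooth_on_differentiable[OF assms(3) that]
      smooth_on_differentiable[OF assms(4) that]
    by (auto simp: weyl_eigen_def intro!: derivative_intros)
  have in_M: "\<exists>x\<in>?M. rz x = p" if "p \<in> U" for p
    using that by (intro bexI[of _ "\<chi> i. if i = 3 then fst p else snd p"]) (auto simp: rz_def spacetime_def)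
  have Gnz: "?G a p \<noteq> 0" if "p \<in> U" for a p
    using in_M[OF that] nz by auto
  have Kd: "K x $ a $ b = (if a = b then ?k a (rz x) * ?G a (rz x) else 0)" if "x \<in> ?M" for x a b
    using assms(5) that by (rule canonical_form_diagonal)
  \<comment> \<open>The Killing equation at a point above \<open>p\<close> descends to the
    half-plane by the chain rule for \<open>rz\<close>.\<close>
  have killing: "pd (rz (axis i 1)) (?k j) p * ?G j p = (?k j p - ?k i p) * pd (rz (axis i 1)) (?G j) p"
    if p: "p \<in> U" for i j p
  proof -
    obtain x where x: "x \<in> ?M" "rz x = p" using in_M[OF p] by blast
    have "coord_pd i (\<lambda>y. ?k j (rz y)) x * ?G j (rz x)
        = (?k j (rz x) - ?k i (rz x)) * coord_pd i (\<lambda>y. ?G j (rz y)) x"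
      by (rule killing_tensor2_diagonal[OF assms(6), where k = "\<lambda>a y. ?k a (rz y)"])
        (use x(1) in \<open>auto simp: Kd spacetime_def intro!: differentiable_rz dG dk\<close>)
    then show ?thesis using x dG[OF p] dk[OF p] by (simp add: pd_rz)
  qed
  have k4: "?k 4 = ?k 3"
    by (simp add: weyl_eigen_def)
  have killing_Basis: "pd v (?k j) p * ?G j p = (?k j p - ?k 3 p) * pd v (?G j) p"
    if "p \<in> U" "v \<in> Basis" for p v j
    using killing[OF that(1), of 3 j] killing[OF that(1), of 4 j] that(2)
    by (auto simp: rz_axis Basis_prod_def k4)
  \<comment> \<open>For $j = 3$ the right-hand side vanishes, so \<open>affine_of_pd\<close> with
    the constant function 1 and offset 0 gives constancy.\<close>
  have "\<exists>N. \<forall>p\<in>U. ?k 3 p = N * 1 + 0"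
    using U by (rule affine_of_pd) (use dk killing_Basis[of _ _ 3] Gnz in auto)
  then obtain c where c: "\<And>p. p \<in> U \<Longrightarrow> ?k 3 p = c" by auto
  \<comment> \<open>Now that $k_3$ is the constant \<open>c\<close>, it can serve as the
    offset.\<close>
  have "\<exists>N. \<forall>p\<in>U. ?k j p = N * ?G j p + c" for j
    using U by (rule affine_of_pd) (use dk dG Gnz killing_Basis c in auto)
  then obtain N where N: "\<And>j p. p \<in> U \<Longrightarrow> ?k j p = N j * ?G j p + c" by metis
  have lam2: "lam2 p = - c" if "p \<in> U" for p
    using c[OF that] by (simp add: weyl_eigen_def)
  have sums: "lam0 p + lam1 p = N 1 * exp (2 * lam p) + c"
    "lam1 p - lam0 p = - (N 2 * (fst p)\<^sup>2 * exp (- 2 * lam p)) + c" if "p \<in> U" for p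
    using N[OF that, of 1] N[OF that, of 2] by (simp_all add: weyl_eigen_def weyl_diag_def)
  have rzU: "rz x \<in> U" if "x \<in> ?M" for x
    using that by (simp add: spacetime_def)
  have cyclic: "coord_pd i (\<lambda>y. ?G a (rz y)) x = 0" if "x \<in> ?M" "i = 1 \<or> i = 2" for i a x
  proof -
    have "(?G a has_derivative frechet_derivative (?G a) (at (rz x))) (at (rz x))"
      using dG[OF rzU[OF that(1)]] by (simp flip: frechet_derivative_works)
    then have "pd 0 (?G a) (rz x) = 0"
      unfolding pd_def by (rule linear_0[OF has_derivative_linear])
    then show ?thesis using that dG[OF rzU] by (auto simp: pd_rz rz_axis)
  qed
  have kv: "killing_vector_on ?M ?g xi_t" "killing_vector_on ?M ?g xi_phi"
    using killing_vector_axis[of 1] killing_vector_axis[of 2] cyclic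
    by (simp_all add: xi_t_def[abs_def] xi_phi_def[abs_def])
  have k34: "?k a (rz x) = c" if "x \<in> ?M" "a \<noteq> 1" "a \<noteq> 2" for a x
    using lam2[OF rzU[OF that(1)]] that by (simp add: weyl_eigen_def)
  have Kc: "K x $ m $ n = N 1 * ((if m = 1 \<and> n = 1 then 1 else 0) * (?G 1 (rz x))\<^sup>2)
      + N 2 * ((if m = 2 \<and> n = 2 then 1 else 0) * (?G 2 (rz x))\<^sup>2)
      + c * (if m = n then ?G m (rz x) else 0)" if "x \<in> ?M" for x m n
    using N[OF rzU[OF that], of 1] N[OF rzU[OF that], of 2] k34[OF that, of m]
    by (auto simp: Kd[OF that] algebra_simps power2_eq_square)
  have lo: "lower ?g xi_t x $ m = (if m = 1 then ?G 1 (rz x) else 0)"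
    "lower ?g xi_phi x $ m = (if m = 2 then ?G 2 (rz x) else 0)" if "x \<in> ?M" for x m
    by (auto simp: lower_def xi_t_def xi_phi_def g[OF that] axis_def mult_delta_left mult_delta_right)
  have "reducible_on ?M ?g K"
    unfolding reducible_on_def
  proof (intro exI conjI allI ballI impI)
    let ?xi = "\<lambda>i::nat. if i = 0 then xi_t else xi_phi"
    let ?C = "\<lambda>i::nat. if i = 0 then N 1 else N 2"
    show "killing_vector_on ?M ?g (?xi i)" "killing_vector_on ?M ?g (?xi i)" for i
      using kv by simp_all
    show "K x = c *\<^sub>R ?g x +
        (\<Sum>i<2. ?C i *\<^sub>R sym_prod (lower ?g (?xi i) x) (lower ?g (?xi i) x))" if "x \<in> ?M" for x
      by (auto simp: vec_eq_iff Kc[OF that] g[OF that] lo[OF that] sym_prod_def numeral_2_eq_2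
          power2_eq_square)
  qed
  moreover have "raise2 ?g K x $ m $ n = N 1 * xi_t x $ m * xi_t x $ n + N 2 * xi_phi x $ m * xi_phi x $ n
      - lam2 (rz x) * ginv ?g x $ m $ n" if x: "x \<in> ?M" for x m n
  proof -
    have raised: "raise2 ?g K x $ m $ n = K x $ m $ n / (?G m (rz x) * ?G n (rz x))"
      by (simp add: raise2_def ginv_diagonal[OF x] mult.assoc flip: sum_distrib_left)
        (simp add: mult_delta_left mult_delta_right flip: sum_divide_distrib)
    show ?thesis
      unfolding raised Kc[OF x] using nz[OF x, of m]
      by (cases "m = n"; cases "m = 1"; cases "m = 2")
        (simp_all add: ginv_diagonal[OF x] lam2[OF rzU[OF x]] xi_t_def xi_phi_def axis_def
          field_simps power2_eq_square)
  qed
  moreover have "lam2 constant_on U"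
    using lam2 by (auto simp: constant_on_def)
  moreover have "lam0 p = (N 1 * exp (2 * lam p) + N 2 * (fst p)\<^sup>2 * exp (- 2 * lam p)) / 2 \<and>
      lam1 p = (N 1 * exp (2 * lam p) - N 2 * (fst p)\<^sup>2 * exp (- 2 * lam p)) / 2 - lam2 p" if "p \<in> U" for p
    using sums[OF that] lam2[OF that] by (simp add: field_simps)
  ultimately show ?thesis by blast
qed

end
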